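(* Let $n,r$ be natural numbers with $r\le n$, let $C_{n,r}=\{\eta\in\{0,1\}^n:\sum_i\eta_i=r\}$ and let $\mu_{n,r}$ be the uniform probability measure on $C_{n,r}$. For $f:C_{n,r}\to\mathbb R$ and $\eta\in C_{n,r}$ put $$\Gamma(f)(\eta)^2=\frac2n\sum_{i<j}\big(f(\eta)-f(\tau_{ij}\eta)\big)^2,\qquad \Gamma^+(f)(\eta)^2=\frac2n\sum_{i<j}\big(f(\eta)-f(\tau_{ij}\eta)\big)_+^2 .$$ Then $\mu_{n,r}$ satisfies a $\Gamma\mathrm{-mLSI}(1)$ and a $\Gamma^+\mathrm{-mLSI}(2)$; that is, for all $f:C_{n,r}\to\mathbb R$ $$\mathrm{Ent}_{\mu_{n,r}}(e^f)\le\frac12\,\mathbb E_{\mu_{n,r}}\big(\Gamma(f)^2e^f\big)\quad\text{and}\quad\mathrm{Ent}_{\mu_{n,r}}(e^f)\le\mathbb E_{\mu_{n,r}}\big(\Gamma^+(f)^2e^f\big).$$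
   Context: $\tau_{ij}\eta$ denotes the configuration obtained from $\eta$ by switching its $i$-th and $j$-th coordinates; sums $\sum_{i<j}$ run over $1\le i<j\le n$; $y_+=\max(y,0)$; $\Gamma(f),\Gamma^+(f)\ge0$ are the non-negative square roots. For $h\ge0$, $\mathrm{Ent}_\mu(h)=\mathbb E_\mu h\log h-\mathbb E_\mu h\,\log(\mathbb E_\mu h)$. A probability measure $\mu$ satisfies a $\Gamma\mathrm{-mLSI}(\rho)$ if $\mathrm{Ent}_\mu(e^f)\le\frac\rho2\mathbb E_\mu(\Gamma(f)^2e^f)$ for all $f$ in the domain of $\Gamma$ (here: all functions $C_{n,r}\to\mathbb R$). *)

theory Defs
  imports "HOL-Probability.Probability" "HOL-Combinatorics.Permutations"
begin

text \<open>
  Elements of \<open>{0,1}\<^sup>n\<close> are extensional functions on \<open>{1..n}\<close>, so that two configurations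
  are equal iff they have the same \<open>n\<close> coordinates.
\<close>

definition slice :: "nat \<Rightarrow> nat \<Rightarrow> (nat \<Rightarrow> nat) set" where
  "slice n r = {\<eta> \<in> {1..n} \<rightarrow>\<^sub>E {0, 1}. (\<Sum>i\<in>{1..n}. \<eta> i) = r}"

definition slice_measure :: "nat \<Rightarrow> nat \<Rightarrow> (nat \<Rightarrow> nat) measure" where
  "slice_measure n r = uniform_count_measure (slice n r)"

definition switch :: "nat \<Rightarrow> nat \<Rightarrow> (nat \<Rightarrow> nat) \<Rightarrow> (nat \<Rightarrow> nat)" where
  "switch i j \<eta> = \<eta> \<circ> Transposition.transpose i j"

text \<open>
  A function on the slice is represented by a function on the whole type. Only its values on
  the slice matter below, by the following closure property.
\<close>

lemma switch_in_slice:
  assumes "\<eta> \<in> slice n r" "i \<in> {1..n}" "j \<in> {1..n}"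
  shows "switch i j \<eta> \<in> slice n r"
proof -
  let ?t = "Transposition.transpose i j"
  have \<eta>: "\<eta> \<in> {1..n} \<rightarrow>\<^sub>E {0, 1}"
    using assms(1) by (simp add: slice_def)
  have perm: "?t permutes {1..n}"
    using assms(2,3) by (rule permutes_swap_id)
  have "(\<Sum>k\<in>{1..n}. \<eta> (?t k)) = (\<Sum>k\<in>{1..n}. \<eta> k)"
    using sum.permute[OF perm, of \<eta>] by (simp add: comp_def)
  moreover have "\<eta> \<circ> ?t \<in> {1..n} \<rightarrow>\<^sub>E {0, 1}"
  proof (rule PiE_I)
    fix k assume "k \<in> {1..n}"
    then have "?t k \<in> {1..n}" by (simp only: permutes_in_image[OF perm])
    then show "(\<eta> \<circ> ?t) k \<in> {0, 1}"
      using PiE_mem[OF \<eta>] by (simp only: comp_apply)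
  next
    fix k assume k: "k \<notin> {1..n}"
    show "(\<eta> \<circ> ?t) k = undefined"
      unfolding comp_apply permutes_not_in[OF perm k] by (rule PiE_arb[OF \<eta> k])
  qed
  ultimately show ?thesis
    using assms(1) by (simp add: slice_def switch_def)
qed

definition Gamma_slice :: "nat \<Rightarrow> ((nat \<Rightarrow> nat) \<Rightarrow> real) \<Rightarrow> (nat \<Rightarrow> nat) \<Rightarrow> real" where
  "Gamma_slice n f \<eta> =
     sqrt (2 / real n * (\<Sum>i\<in>{1..n}. \<Sum>j\<in>{i<..n}. (f \<eta> - f (switch i j \<eta>))\<^sup>2))"

definition Gamma_slice_plus :: "nat \<Rightarrow> ((nat \<Rightarrow> nat) \<Rightarrow> real) \<Rightarrow> (nat \<Rightarrow> nat) \<Rightarrow> real" where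
  "Gamma_slice_plus n f \<eta> =
     sqrt (2 / real n * (\<Sum>i\<in>{1..n}. \<Sum>j\<in>{i<..n}. (max (f \<eta> - f (switch i j \<eta>)) 0)\<^sup>2))"

definition Ent :: "'a measure \<Rightarrow> ('a \<Rightarrow> real) \<Rightarrow> real" where
  "Ent \<mu> h = (LINT x|\<mu>. h x * ln (h x)) - (LINT x|\<mu>. h x) * ln (LINT x|\<mu>. h x)"

text \<open>
  The domain of \<open>\<Gamma>\<close> is taken to be all functions, which is appropriate when \<open>\<mu>\<close> lives on a
  finite discrete space: there every function is integrable.
\<close>

definition mLSI :: "'a measure \<Rightarrow> (('a \<Rightarrow> real) \<Rightarrow> 'a \<Rightarrow> real) \<Rightarrow> real \<Rightarrow> bool" where
  "mLSI \<mu> \<Gamma> \<rho> \<longleftrightarrow> prob_space \<mu> \<and>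
     (\<forall>f. Ent \<mu> (\<lambda>x. exp (f x)) \<le> \<rho> / 2 * (LINT x|\<mu>. (\<Gamma> f x)\<^sup>2 * exp (f x)))"

end

theory Submission
  imports Defs
begin

text \<open>
  Both inequalities follow from the entropy bound
  \<open>n Ent(F) \<le> E \<Sum>\<^bsub>i<j\<^esub> (F - F \<circ> \<tau>\<^sub>i\<^sub>j) (ln F - ln (F \<circ> \<tau>\<^sub>i\<^sub>j))\<close>, combined with
  \<open>(e\<^sup>x - e\<^sup>y) (x - y) \<le> (e\<^sup>x + e\<^sup>y) (x - y)\<^sup>2 / 2\<close> for \<open>\<Gamma>\<close> and
  \<open>(e\<^sup>x - e\<^sup>y) (x - y) \<le> e\<^sup>x (x - y)\<^sup>2\<close> (\<open>x \<ge> y\<close>) for \<open>\<Gamma>\<^sup>+\<close>, and the invariance of the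
  uniform measure under \<open>\<tau>\<^sub>i\<^sub>j\<close>. The entropy bound is proved by induction on \<open>n\<close>:
  conditioning on one coordinate \<open>i\<close> splits the entropy into the two conditional entropies and that of
  a function on two points; the latter is controlled by Jensen's inequality and, through the
  transpositions moving \<open>i\<close>, by the log-sum inequality. Averaging over \<open>i\<close> closes the induction
  because \<open>(n - 2) / (n - 1) + 1 / n \<le> 1\<close>.
\<close>

section \<open>Subset encoding, entropy and energy\<close>

text \<open>Configurations are encoded by their supports. The ground set is arbitrary because the
  induction deletes an arbitrary element from it.\<close>

definition layer :: "'a set \<Rightarrow> nat \<Rightarrow> 'a set set" where
  "layer A r = {B. B \<subseteq> A \<and> card B = r}"

text \<open>The summand of the Dirichlet form of \<open>F\<close> against \<open>ln F\<close>:
  symmetric in its arguments and homogeneous of degree one.\<close>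

definition log_gap :: "real \<Rightarrow> real \<Rightarrow> real" where
  "log_gap a b = (a - b) * (ln a - ln b)"

text \<open>Entropy under the uniform probability on \<open>X\<close>, multiplied by \<open>card X\<close>.\<close>

definition entropy_sum :: "'a set \<Rightarrow> ('a \<Rightarrow> real) \<Rightarrow> real" where
  "entropy_sum X F = (\<Sum>x\<in>X. F x * ln (F x)) - sum F X * ln (sum F X / real (card X))"

text \<open>Each unordered pair with exactly one element in \<open>B\<close> occurs once; the other transpositions fix \<open>B\<close>.\<close>

definition layer_energy :: "'a set \<Rightarrow> nat \<Rightarrow> ('a set \<Rightarrow> real) \<Rightarrow> real" where
  "layer_energy A r F =
     (\<Sum>B\<in>layer A r. \<Sum>j\<in>B. \<Sum>k\<in>A - B. log_gap (F B) (F (insert k (B - {j}))))"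

section \<open>Logarithmic inequalities\<close>

lemma log_gap_nonneg: "a > 0 \<Longrightarrow> b > 0 \<Longrightarrow> log_gap a b \<ge> 0"
  by (cases a b rule: linorder_cases) (auto simp: log_gap_def mult_nonneg_nonneg mult_nonpos_nonpos)

lemma log_gap_scale: "c > 0 \<Longrightarrow> a > 0 \<Longrightarrow> b > 0 \<Longrightarrow> log_gap (c * a) (c * b) = c * log_gap a b"
  by (simp add: log_gap_def ln_mult algebra_simps)

text \<open>Apply \<open>ln x \<le> x - 1\<close> to the ratio of \<open>b p / a p\<close> to
  \<open>?B / ?A\<close>. After multiplication by \<open>a p\<close> the error terms are
  \<open>a p\<close> and \<open>?A / ?B * b p\<close>, which cancel when summed over
  \<open>P\<close>.\<close>

lemma log_sum_inequality:
  fixes a b :: "'i \<Rightarrow> real"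
  assumes "finite P" "P \<noteq> {}" "\<And>p. p \<in> P \<Longrightarrow> a p > 0" "\<And>p. p \<in> P \<Longrightarrow> b p > 0"
  shows "sum a P * (ln (sum a P) - ln (sum b P)) \<le> (\<Sum>p\<in>P. a p * (ln (a p) - ln (b p)))"
proof -
  let ?A = "sum a P" and ?B = "sum b P"
  have A: "?A > 0" and B: "?B > 0"
    using assms by (auto intro!: sum_pos)
  have "a p * (ln ?A - ln ?B) + a p - ?A / ?B * b p \<le> a p * (ln (a p) - ln (b p))" if "p \<in> P" for p
  proof -
    have a: "a p > 0" and b: "b p > 0" using assms that by auto
    have "ln (?A * b p / (?B * a p)) \<le> ?A * b p / (?B * a p) - 1"
      using A B a b by (intro ln_le_minus_one) auto
    moreover have "ln (?A * b p / (?B * a p)) = ln ?A + ln (b p) - ln ?B - ln (a p)"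
      using A B a b by (simp add: ln_div ln_mult)
    ultimately have "ln ?A - ln ?B + 1 - ?A * b p / (?B * a p) \<le> ln (a p) - ln (b p)" by linarith
    then have "a p * (ln ?A - ln ?B + 1 - ?A * b p / (?B * a p)) \<le> a p * (ln (a p) - ln (b p))"
      by (rule mult_left_mono) (use a in simp)
    moreover have "a p * (?A * b p / (?B * a p)) = ?A / ?B * b p"
      using a by simp
    ultimately show ?thesis by (simp only: distrib_left right_diff_distrib mult_1_right)
  qed
  then have "(\<Sum>p\<in>P. a p * (ln ?A - ln ?B) + a p - ?A / ?B * b p) \<le> (\<Sum>p\<in>P. a p * (ln (a p) - ln (b p)))"
    by (rule sum_mono)
  moreover have "(\<Sum>p\<in>P. a p * (ln ?A - ln ?B) + a p - ?A / ?B * b p) = ?A * (ln ?A - ln ?B)"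
  proof -
    have "(\<Sum>p\<in>P. a p * (ln ?A - ln ?B) + a p - ?A / ?B * b p) = ?A * (ln ?A - ln ?B) + ?A - ?A / ?B * ?B"
      by (simp only: sum.distrib sum_subtractf sum_distrib_left sum_distrib_right)
    with B show ?thesis by simp
  qed
  ultimately show ?thesis by simp
qed

text \<open>\<open>log_gap a b\<close> is the symmetrised relative entropy
  \<open>a ln (a/b) + b ln (b/a)\<close>, so the log-sum inequality is used in both orders. With
  homogeneity this amounts to joint convexity.\<close>

lemma log_gap_sum_le:
  fixes a b :: "'i \<Rightarrow> real"
  assumes "finite P" "P \<noteq> {}" "\<And>p. p \<in> P \<Longrightarrow> a p > 0" "\<And>p. p \<in> P \<Longrightarrow> b p > 0"
  shows "log_gap (sum a P) (sum b P) \<le> (\<Sum>p\<in>P. log_gap (a p) (b p))"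
proof -
  have "(\<Sum>p\<in>P. log_gap (a p) (b p)) =
      (\<Sum>p\<in>P. a p * (ln (a p) - ln (b p))) + (\<Sum>p\<in>P. b p * (ln (b p) - ln (a p)))"
    by (simp add: log_gap_def algebra_simps flip: sum.distrib)
  moreover have "log_gap (sum a P) (sum b P) =
      sum a P * (ln (sum a P) - ln (sum b P)) + sum b P * (ln (sum b P) - ln (sum a P))"
    by (simp add: log_gap_def algebra_simps)
  moreover note log_sum_inequality[of P a b, OF assms] log_sum_inequality[of P b a, OF assms(1,2,4,3)]
  ultimately show ?thesis by linarith
qed

text \<open>The left side is the entropy of a function with values \<open>m0\<close>,
  \<open>m1\<close> on atoms of mass \<open>N0\<close>, \<open>N1\<close>. Jensen's inequality
  replaces the logarithm of the mean by the mean of the logarithms; what remains is a multiple of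
  the covariance of the function and its logarithm.\<close>

lemma two_point_entropy_le:
  fixes N0 N1 m0 m1 :: real
  assumes "N0 > 0" "N1 > 0" "m0 > 0" "m1 > 0"
  shows "N0 * m0 * ln m0 + N1 * m1 * ln m1
           - (N0 * m0 + N1 * m1) * ln ((N0 * m0 + N1 * m1) / (N0 + N1))
         \<le> N0 * N1 / (N0 + N1) * log_gap m1 m0"
proof -
  define N where "N = N0 + N1"
  define m where "m = (N0 * m0 + N1 * m1) / N"
  have N: "N > 0" and m: "m > 0" using assms by (simp_all add: N_def m_def add_pos_pos)
  have Nm: "N * m = N0 * m0 + N1 * m1" using N by (simp add: m_def)
  \<comment> \<open>The tangent of \<open>ln\<close> at the weighted mean \<open>m\<close>: with
    weights \<open>N0\<close>, \<open>N1\<close> the linear terms add up to zero, which gives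
    Jensen's inequality \<open>J\<close>.\<close>
  have l: "ln x - ln m \<le> x / m - 1" if "x > 0" for x
    using ln_le_minus_one[of "x / m"] that m by (simp add: ln_div)
  have "N0 * (ln m0 - ln m) + N1 * (ln m1 - ln m) \<le> N0 * (m0 / m - 1) + N1 * (m1 / m - 1)"
    using assms by (intro add_mono mult_left_mono l) auto
  also have "\<dots> = (N0 * m0 + N1 * m1) / m - N"
    by (simp add: N_def algebra_simps add_divide_distrib)
  also have "\<dots> = 0" using m by (simp flip: Nm)
  finally have J: "N0 * ln m0 + N1 * ln m1 \<le> N * ln m"
    by (simp add: N_def algebra_simps)
  have "N * (N0 * m0 * ln m0 + N1 * m1 * ln m1 - N * m * ln m)
     = N * (N0 * m0 * ln m0 + N1 * m1 * ln m1) - N * m * (N * ln m)"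
    by (simp add: algebra_simps)
  also have "\<dots> \<le> N * (N0 * m0 * ln m0 + N1 * m1 * ln m1) - N * m * (N0 * ln m0 + N1 * ln m1)"
    using J N m by (intro diff_left_mono mult_left_mono) auto
  also have "\<dots> = N0 * N1 * log_gap m1 m0"
    unfolding Nm by (simp add: N_def log_gap_def algebra_simps)
  finally have "N0 * m0 * ln m0 + N1 * m1 * ln m1 - N * m * ln m \<le> N0 * N1 * log_gap m1 m0 / N"
    using N by (simp add: pos_le_divide_eq mult.commute)
  then have "N0 * m0 * ln m0 + N1 * m1 * ln m1 - N * m * ln m \<le> N0 * N1 / N * log_gap m1 m0"
    by simp
  then show ?thesis unfolding Nm unfolding m_def N_def .
qed

section \<open>Double counting over layers\<close>

lemma finite_layer: "finite A \<Longrightarrow> finite (layer A r)"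
  by (simp add: layer_def)

lemma layer_nonempty: "finite A \<Longrightarrow> r \<le> card A \<Longrightarrow> layer A r \<noteq> {}"
  unfolding layer_def by (metis (mono_tags, lifting) empty_Collect_eq obtain_subset_with_card_n)

lemma sum_layer_insert:
  assumes "finite A" "i \<notin> A"
  shows "sum g (layer (insert i A) (Suc s)) =
     sum g (layer A (Suc s)) + (\<Sum>B\<in>layer A s. g (insert i B))"
proof -
  have fin: "finite B" if "B \<subseteq> A" for B using assms that finite_subset by blast
  have "layer (insert i A) (Suc s) = layer A (Suc s) \<union> insert i ` layer A s"
  proof (intro equalityI subsetI)
    fix B assume B: "B \<in> layer (insert i A) (Suc s)"
    show "B \<in> layer A (Suc s) \<union> insert i ` layer A s"
    proof (cases "i \<in> B")
      case True
      then have "B = insert i (B - {i})" "B - {i} \<in> layer A s"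
        using B by (auto simp: layer_def)
      then show ?thesis by blast
    qed (use B in \<open>auto simp: layer_def\<close>)
  next
    fix B assume B: "B \<in> layer A (Suc s) \<union> insert i ` layer A s"
    then show "B \<in> layer (insert i A) (Suc s)"
      using assms fin by (fastforce simp: layer_def card_insert_if)
  qed
  moreover have "layer A (Suc s) \<inter> insert i ` layer A s = {}"
    using assms by (auto simp: layer_def)
  moreover have "inj_on (insert i) (layer A s)"
    using assms by (auto simp: inj_on_def layer_def)
  ultimately show ?thesis
    using assms by (simp add: sum.union_disjoint finite_layer sum.reindex)
qed

text \<open>Adding \<open>k\<close> to \<open>B\<close> is a bijection from pairs with
  \<open>k\<close> outside \<open>B\<close> to pairs with \<open>k\<close> inside \<open>C\<close>;
  its inverse removes \<open>k\<close>.\<close>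

lemma sum_layer_up:
  assumes "finite A"
  shows "(\<Sum>B\<in>layer A s. \<Sum>k\<in>A - B. h k B) = (\<Sum>C\<in>layer A (Suc s). \<Sum>k\<in>C. h k (C - {k}))"
proof -
  have fin: "finite B" if "B \<subseteq> A" for B using assms that finite_subset by blast
  have "(\<Sum>B\<in>layer A s. \<Sum>k\<in>A - B. h k B) = (\<Sum>(B, k)\<in>Sigma (layer A s) (\<lambda>B. A - B). h k B)"
    using assms by (intro sum.Sigma) (auto simp: finite_layer)
  also have "\<dots> = (\<Sum>(C, k)\<in>Sigma (layer A (Suc s)) (\<lambda>C. C). h k (C - {k}))"
    by (rule sum.reindex_bij_witness[where i = "\<lambda>(C, k). (C - {k}, k)"
          and j = "\<lambda>(B, k). (insert k B, k)"])
       (auto simp: layer_def insert_absorb dest: fin)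
  also have "\<dots> = (\<Sum>C\<in>layer A (Suc s). \<Sum>k\<in>C. h k (C - {k}))"
    using assms by (intro sum.Sigma[symmetric]) (auto simp: finite_layer layer_def dest: fin)
  finally show ?thesis .
qed

lemma sum_layer_remove:
  assumes "finite A"
  shows "(\<Sum>i\<in>A. \<Sum>B\<in>layer (A - {i}) s. h i B) = (\<Sum>B\<in>layer A s. \<Sum>i\<in>A - B. h i B)"
proof -
  have "(\<Sum>i\<in>A. \<Sum>B\<in>layer (A - {i}) s. h i B) = (\<Sum>i\<in>A. \<Sum>B\<in>{B \<in> layer A s. i \<notin> B}. h i B)"
    by (intro sum.cong) (auto simp: layer_def)
  also have "\<dots> = (\<Sum>B\<in>layer A s. \<Sum>i\<in>{i \<in> A. i \<notin> B}. h i B)"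
    using assms by (intro sum.swap_restrict) (auto simp: finite_layer)
  finally show ?thesis by (simp add: set_diff_eq)
qed

section \<open>Conditioning on one coordinate\<close>

text \<open>By the chain rule, entropy is the two conditional entropies plus that of the two
  conditional means \<open>m0\<close> (without \<open>i\<close>) and \<open>m1\<close> (with
  \<open>i\<close>). The latter is at most a multiple of \<open>log_gap m1 m0\<close>, which is
  compared with the moves replacing \<open>i\<close> by some \<open>k\<close>.\<close>

lemma entropy_sum_layer_insert_le:
  assumes A: "finite A" "i \<notin> A" and s: "s < card A" and F: "\<And>B. F B > 0"
  shows "real (Suc (card A)) * entropy_sum (layer (insert i A) (Suc s)) F \<le>
     real (Suc (card A)) * (entropy_sum (layer A (Suc s)) F + entropy_sum (layer A s) (\<lambda>B. F (insert i B)))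
     + (\<Sum>B\<in>layer A s. \<Sum>k\<in>A - B. log_gap (F (insert i B)) (F (insert k B)))"
proof -
  define N0 N1 where "N0 = real (card (layer A (Suc s)))" and "N1 = real (card (layer A s))"
  define S0 S1 where "S0 = sum F (layer A (Suc s))" and "S1 = (\<Sum>B\<in>layer A s. F (insert i B))"
  define m0 m1 where "m0 = S0 / N0" and "m1 = S1 / N1"
  \<comment> \<open>The number of ways to add one element of \<open>A\<close> to a member of
    \<open>layer A s\<close>.\<close>
  define q where "q = real (card A - s)"
  define n where "n = real (Suc (card A))"
  note fin = finite_layer[OF A(1)]
  have ne: "layer A (Suc s) \<noteq> {}" "layer A s \<noteq> {}"
    using layer_nonempty[OF A(1)] s by auto
  have N: "N0 > 0" "N1 > 0"
    using ne fin by (auto simp: N0_def N1_def card_gt_0_iff)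
  have S: "S0 > 0" "S1 > 0"
    using ne fin F by (auto simp: S0_def S1_def intro!: sum_pos)
  have m: "m0 > 0" "m1 > 0" and Nm: "N0 * m0 = S0" "N1 * m1 = S1"
    using N S by (auto simp: m0_def m1_def)
  have q: "q > 0" and nq: "n = q + real (Suc s)"
    using s by (auto simp: q_def n_def of_nat_diff)
  have card_compl: "card (A - B) = card A - s" if "B \<in> layer A s" for B
    using that A by (auto simp: layer_def card_Diff_subset finite_subset)
  have card_mem: "card B = Suc s" if "B \<in> layer A (Suc s)" for B
    using that by (simp add: layer_def)
  have up: "(\<Sum>B\<in>layer A s. \<Sum>k\<in>A - B. G (insert k B)) = real (Suc s) * sum G (layer A (Suc s))"
    for G :: "'a set \<Rightarrow> real"
  proof -
    have "(\<Sum>B\<in>layer A s. \<Sum>k\<in>A - B. G (insert k B)) = (\<Sum>C\<in>layer A (Suc s). \<Sum>k\<in>C. G C)"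
      unfolding sum_layer_up[OF A(1)] by (intro sum.cong refl) (simp add: insert_absorb)
    then show ?thesis by (simp add: card_mem sum_distrib_left)
  qed
  \<comment> \<open>Both sides count the pairs of an \<open>s\<close>-subset and an element of
    \<open>A\<close> outside it: each \<open>s\<close>-subset has \<open>q\<close> extensions, each
    larger set \<open>Suc s\<close> predecessors.\<close>
  have count: "q * N1 = real (Suc s) * N0"
    using up[of "\<lambda>_. 1"] by (simp add: card_compl q_def N1_def N0_def mult.commute)
  \<comment> \<open>This makes the two-point constant \<open>N0 * N1 / (N0 + N1)\<close>, multiplied
    by \<open>n\<close>, equal to \<open>q * N1\<close>.\<close>
  have nN: "n * N0 = q * (N0 + N1)"
    using count by (simp add: nq algebra_simps)
  define P where "P = Sigma (layer A s) (\<lambda>B. A - B)"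
  have P: "(\<Sum>B\<in>layer A s. \<Sum>k\<in>A - B. g B k) = (\<Sum>(B, k)\<in>P. g B k)" for g :: "'a set \<Rightarrow> 'a \<Rightarrow> real"
    unfolding P_def using A by (intro sum.Sigma) (auto simp: fin)
  have Pa: "(\<Sum>(B, k)\<in>P. F (insert i B)) = q * N1 * m1"
    unfolding P[symmetric] by (simp add: card_compl Nm mult.assoc S1_def sum_distrib_left q_def)
  have Pb: "(\<Sum>(B, k)\<in>P. F (insert k B)) = q * N1 * m0"
    unfolding P[symmetric] up count by (simp add: Nm mult.assoc S0_def)
  \<comment> \<open>The pairs in \<open>P\<close> couple the two halves: \<open>insert i B\<close>
    meets every set containing \<open>i\<close> equally often, and \<open>insert k B\<close> every
    set avoiding \<open>i\<close>. Hence both sums over \<open>P\<close> are the same multiple of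
    the means, and subadditivity of \<open>log_gap\<close> applies.\<close>
  have "q * N1 * log_gap m1 m0 = log_gap (q * N1 * m1) (q * N1 * m0)"
    using q N m by (intro log_gap_scale[symmetric]) auto
  also have "\<dots> \<le> (\<Sum>p\<in>P. log_gap ((\<lambda>(B, k). F (insert i B)) p) ((\<lambda>(B, k). F (insert k B)) p))"
    unfolding Pa[symmetric] Pb[symmetric]
  proof (rule log_gap_sum_le)
    show "finite P" unfolding P_def using A by (simp add: fin)
    obtain B where "B \<in> layer A s" using ne by blast
    with card_compl[of B] s have "A - B \<noteq> {}" by fastforce
    with \<open>B \<in> layer A s\<close> show "P \<noteq> {}" unfolding P_def by blast
  qed (auto simp: F)
  also have "\<dots> = (\<Sum>B\<in>layer A s. \<Sum>k\<in>A - B. log_gap (F (insert i B)) (F (insert k B)))" (is "_ = ?U")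
    unfolding P by (simp add: case_prod_unfold)
  finally have U: "q * N1 * log_gap m1 m0 \<le> ?U" .
  let ?X = "layer (insert i A) (Suc s)"
  have cardX: "real (card ?X) = N0 + N1"
    using sum_layer_insert[OF A, of "\<lambda>_. 1::real" s] by (simp add: N0_def N1_def)
  have sumX: "sum F ?X = S0 + S1"
    by (simp add: sum_layer_insert[OF A] S0_def S1_def)
  have "entropy_sum ?X F - (entropy_sum (layer A (Suc s)) F + entropy_sum (layer A s) (\<lambda>B. F (insert i B)))
      = N0 * m0 * ln m0 + N1 * m1 * ln m1
           - (N0 * m0 + N1 * m1) * ln ((N0 * m0 + N1 * m1) / (N0 + N1))"
  proof -
    let ?T = "\<lambda>B. F B * ln (F B)"
    have "entropy_sum ?X F = sum ?T (layer A (Suc s)) + (\<Sum>B\<in>layer A s. ?T (insert i B))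
        - (S0 + S1) * ln ((S0 + S1) / (N0 + N1))"
      unfolding entropy_sum_def cardX sumX by (subst sum_layer_insert[OF A]) (rule refl)
    moreover have "entropy_sum (layer A (Suc s)) F = sum ?T (layer A (Suc s)) - S0 * ln m0"
      unfolding entropy_sum_def m0_def S0_def N0_def ..
    moreover have "entropy_sum (layer A s) (\<lambda>B. F (insert i B)) =
        (\<Sum>B\<in>layer A s. ?T (insert i B)) - S1 * ln m1"
      unfolding entropy_sum_def m1_def S1_def N1_def ..
    ultimately show ?thesis unfolding Nm by linarith
  qed
  also have "\<dots> \<le> N0 * N1 / (N0 + N1) * log_gap m1 m0"
    by (rule two_point_entropy_le) (use N m in auto)
  finally have "n * (entropy_sum ?X F - (entropy_sum (layer A (Suc s)) F + entropy_sum (layer A s) (\<lambda>B. F (insert i B))))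
      \<le> n * (N0 * N1 / (N0 + N1) * log_gap m1 m0)"
    by (rule mult_left_mono) (simp add: n_def)
  also have "\<dots> = (n * N0) * N1 / (N0 + N1) * log_gap m1 m0" by simp
  also have "\<dots> = q * N1 * log_gap m1 m0"
    unfolding nN using N by simp
  also note U
  finally show ?thesis by (simp add: n_def algebra_simps)
qed

section \<open>Averaging over the coordinate and induction\<close>

lemma entropy_sum_singleton [simp]: "entropy_sum {x} F = 0"
  by (simp add: entropy_sum_def)

lemma layer_energy_nonneg: "(\<And>B. F B > 0) \<Longrightarrow> layer_energy A r F \<ge> 0"
  unfolding layer_energy_def by (intro sum_nonneg log_gap_nonneg) auto

text \<open>The exchange of \<open>j\<close> and \<open>k\<close> survives conditioning on
  \<open>i\<close> exactly when \<open>i\<close> differs from both, which holds for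
  \<open>m - 1\<close> of the \<open>Suc m\<close> elements.\<close>

lemma sum_layer_energy_remove:
  assumes A: "finite A" "card A = Suc m" "m > 0"
  shows "(\<Sum>i\<in>A. layer_energy (A - {i}) (Suc s) F + layer_energy (A - {i}) s (\<lambda>B. F (insert i B)))
     = real (m - 1) * layer_energy A (Suc s) F"
proof -
  define w where "w B j k = log_gap (F B) (F (insert k (B - {j})))" for B j k
  \<comment> \<open>Sets avoiding \<open>i\<close> and sets containing \<open>i\<close> together:
    the two conditional energies collect the moves of the full layer that leave \<open>i\<close>
    untouched.\<close>
  have "layer_energy (A - {i}) (Suc s) F + layer_energy (A - {i}) s (\<lambda>B. F (insert i B))
      = (\<Sum>B\<in>layer A (Suc s). \<Sum>j\<in>B - {i}. \<Sum>k\<in>A - B - {i}. w B j k)" if "i \<in> A" for i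
  proof -
    have ins: "insert i (A - {i}) = A" using that by blast
    have "(\<Sum>B\<in>layer A (Suc s). \<Sum>j\<in>B - {i}. \<Sum>k\<in>A - B - {i}. w B j k) =
        (\<Sum>B\<in>layer (A - {i}) (Suc s). \<Sum>j\<in>B - {i}. \<Sum>k\<in>A - B - {i}. w B j k) +
        (\<Sum>B\<in>layer (A - {i}) s. \<Sum>j\<in>insert i B - {i}. \<Sum>k\<in>A - insert i B - {i}. w (insert i B) j k)"
      using sum_layer_insert[of "A - {i}" i "\<lambda>B. \<Sum>j\<in>B - {i}. \<Sum>k\<in>A - B - {i}. w B j k" s] A ins by simp
    also have "(\<Sum>B\<in>layer (A - {i}) (Suc s). \<Sum>j\<in>B - {i}. \<Sum>k\<in>A - B - {i}. w B j k)
        = layer_energy (A - {i}) (Suc s) F"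
      unfolding layer_energy_def w_def by (intro sum.cong refl) (auto simp: layer_def)
    also have "(\<Sum>B\<in>layer (A - {i}) s. \<Sum>j\<in>insert i B - {i}. \<Sum>k\<in>A - insert i B - {i}. w (insert i B) j k)
        = layer_energy (A - {i}) s (\<lambda>B. F (insert i B))"
      unfolding layer_energy_def
    proof (intro sum.cong refl)
      fix B j k assume B: "B \<in> layer (A - {i}) s" and j: "j \<in> B" 
      then have "insert k (insert i B - {j}) = insert i (insert k (B - {j}))"
        by (auto simp: layer_def)
      then show "w (insert i B) j k = log_gap (F (insert i B)) (F (insert i (insert k (B - {j}))))"
        by (simp add: w_def)
    qed (auto simp: layer_def)
    finally show ?thesis by simp
  qed
  then have "(\<Sum>i\<in>A. layer_energy (A - {i}) (Suc s) F + layer_energy (A - {i}) s (\<lambda>B. F (insert i B)))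
      = (\<Sum>i\<in>A. \<Sum>B\<in>layer A (Suc s). \<Sum>j\<in>B - {i}. \<Sum>k\<in>A - B - {i}. w B j k)"
    by simp
  also have "\<dots> = (\<Sum>B\<in>layer A (Suc s). \<Sum>i\<in>A. \<Sum>j\<in>B - {i}. \<Sum>k\<in>A - B - {i}. w B j k)"
    by (rule sum.swap)
  also have "\<dots> = (\<Sum>B\<in>layer A (Suc s). real (m - 1) * (\<Sum>j\<in>B. \<Sum>k\<in>A - B. w B j k))"
  proof (intro sum.cong refl)
    fix B assume "B \<in> layer A (Suc s)"
    then have B: "B \<subseteq> A" "finite B" using A finite_subset by (auto simp: layer_def)
    have "(\<Sum>i\<in>A. \<Sum>j\<in>B - {i}. \<Sum>k\<in>A - B - {i}. w B j k) =
        (\<Sum>i\<in>A. \<Sum>p\<in>{p \<in> B \<times> (A - B). i \<noteq> fst p \<and> i \<noteq> snd p}. w B (fst p) (snd p))"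
      unfolding sum.cartesian_product
      by (intro sum.cong) (auto simp: case_prod_unfold)
    also have "\<dots> = (\<Sum>p\<in>B \<times> (A - B). \<Sum>i\<in>{i \<in> A. i \<noteq> fst p \<and> i \<noteq> snd p}. w B (fst p) (snd p))"
      using A B by (intro sum.swap_restrict) auto
    also have "\<dots> = (\<Sum>p\<in>B \<times> (A - B). real (m - 1) * w B (fst p) (snd p))"
    proof (intro sum.cong refl)
      fix p assume p: "p \<in> B \<times> (A - B)"
      have "{i \<in> A. i \<noteq> fst p \<and> i \<noteq> snd p} = A - {fst p, snd p}" by auto
      moreover have "card (A - {fst p, snd p}) = m - 1"
        using p A B by (subst card_Diff_subset) (auto simp: card_insert_if)
      ultimately show "(\<Sum>i\<in>{i \<in> A. i \<noteq> fst p \<and> i \<noteq> snd p}. w B (fst p) (snd p)) = real (m - 1) * w B (fst p) (snd p)"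
        by simp
    qed
    finally show "(\<Sum>i\<in>A. \<Sum>j\<in>B - {i}. \<Sum>k\<in>A - B - {i}. w B j k) = real (m - 1) * (\<Sum>j\<in>B. \<Sum>k\<in>A - B. w B j k)"
      by (simp add: sum.cartesian_product case_prod_unfold flip: sum_distrib_left)
  qed
  finally show ?thesis
    by (simp add: layer_energy_def w_def sum_distrib_left)
qed

text \<open>Each move taking \<open>j\<close> out of a set is counted once, namely for
  \<open>i = j\<close>.\<close>

lemma sum_layer_boundary:
  assumes "finite A"
  shows "(\<Sum>i\<in>A. \<Sum>B\<in>layer (A - {i}) s. \<Sum>k\<in>A - {i} - B. log_gap (F (insert i B)) (F (insert k B)))
     = layer_energy A (Suc s) F"
  unfolding sum_layer_remove[OF assms] sum_layer_up[OF assms] layer_energy_def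
proof (rule sum.cong[OF refl], rule sum.cong[OF refl])
  fix B :: "'a set" and i :: 'a assume "i \<in> B"
  then have "A - {i} - (B - {i}) = A - B" "insert i (B - {i}) = B" by blast+
  then show "(\<Sum>k\<in>A - {i} - (B - {i}). log_gap (F (insert i (B - {i}))) (F (insert k (B - {i}))))
      = (\<Sum>k\<in>A - B. log_gap (F B) (F (insert k (B - {i}))))"
    by simp
qed

lemma layer_modified_log_sobolev:
  assumes "finite A" "r \<le> card A" "\<And>B. F B > 0"
  shows "real (card A) * entropy_sum (layer A r) F \<le> layer_energy A r F"
  using assms
proof (induction "card A" arbitrary: A r F)
  case 0
  then show ?case by (simp add: layer_energy_nonneg)
next
  case (Suc m A r F)
  note A = \<open>finite A\<close> and F = \<open>\<And>B. F B > 0\<close>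
  have cA: "card A = Suc m" using Suc by simp
  show ?case
  \<comment> \<open>For extreme \<open>r\<close> the layer is a single point and has no entropy.
    Otherwise both conditional layers are nonempty and the induction hypothesis covers them.\<close>
  proof (cases "r = 0 \<or> r = card A")
    case True
    then have "layer A r = {{}} \<or> layer A r = {A}"
    proof
      assume "r = 0"
      moreover have "B = {}" if "B \<subseteq> A" "card B = 0" for B
        using that A by (metis card_0_eq finite_subset)
      ultimately have "layer A r = {{}}" by (auto simp: layer_def)
      then show ?thesis ..
    next
      assume "r = card A"
      then have "layer A r = {A}" using A card_subset_eq[OF A] by (auto simp: layer_def)
      then show ?thesis ..
    qed
    then have "entropy_sum (layer A r) F = 0"
      by (elim disjE) simp_all
    then show ?thesis using layer_energy_nonneg[OF F] by simp
  next
    case False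
    then obtain s where r: "r = Suc s" and s: "s < m"
      using Suc.prems cA by (cases r) auto
    define e where "e = entropy_sum (layer A r) F"
    define E where "E i = layer_energy (A - {i}) (Suc s) F + layer_energy (A - {i}) s (\<lambda>B. F (insert i B))" for i
    define U where "U i = (\<Sum>B\<in>layer (A - {i}) s. \<Sum>k\<in>A - {i} - B. log_gap (F (insert i B)) (F (insert k B)))" for i
    \<comment> \<open>The factor \<open>real m\<close> comes from the induction hypothesis on
      \<open>m\<close> elements, \<open>real (Suc m)\<close> from the conditioning bound.\<close>
    have step: "real m * real (Suc m) * e \<le> real (Suc m) * E i + real m * U i" if i: "i \<in> A" for i
    proof -
      let ?A = "A - {i}"
      let ?e0 = "entropy_sum (layer ?A (Suc s)) F" and ?e1 = "entropy_sum (layer ?A s) (\<lambda>B. F (insert i B))"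
      have c: "card ?A = m" and ins: "insert i ?A = A" using i A cA by auto
      have "real m * ?e0 \<le> layer_energy ?A (Suc s) F"
        using Suc.hyps(1)[of ?A "Suc s" F] c A s F by simp
      moreover have "real m * ?e1 \<le> layer_energy ?A s (\<lambda>B. F (insert i B))"
        using Suc.hyps(1)[of ?A s "\<lambda>B. F (insert i B)"] c A s F by simp
      ultimately have "real m * (?e0 + ?e1) \<le> E i" by (simp add: E_def algebra_simps)
      then have "real (Suc m) * (real m * (?e0 + ?e1)) \<le> real (Suc m) * E i"
        by (rule mult_left_mono) simp
      moreover have "real (Suc m) * e \<le> real (Suc m) * (?e0 + ?e1) + U i"
        using entropy_sum_layer_insert_le[of ?A i s F] A F s
        unfolding c ins e_def r U_def by simp
      then have "real m * (real (Suc m) * e) \<le> real m * (real (Suc m) * (?e0 + ?e1) + U i)"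
        by (rule mult_left_mono) simp
      ultimately show ?thesis by (simp add: algebra_simps)
    qed
    have "real (Suc m) * (real m * real (Suc m) * e) = (\<Sum>i\<in>A. real m * real (Suc m) * e)"
      by (simp add: cA)
    also have "\<dots> \<le> (\<Sum>i\<in>A. real (Suc m) * E i + real m * U i)"
      by (rule sum_mono) (rule step)
    also have "\<dots> = real (Suc m) * (\<Sum>i\<in>A. E i) + real m * (\<Sum>i\<in>A. U i)"
      by (simp add: sum.distrib sum_distrib_left)
    also have "\<dots> = real (Suc m) * (real (m - 1) * layer_energy A r F) + real m * layer_energy A r F"
      unfolding E_def U_def r using sum_layer_energy_remove[OF A cA] sum_layer_boundary[OF A] s by simp
    \<comment> \<open>Here \<open>(m + 1) * (m - 1) + m = m * (m + 1) - 1\<close>.\<close>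
    also have "\<dots> \<le> real m * real (Suc m) * layer_energy A r F"
      using s layer_energy_nonneg[of F A r, OF F] by (simp add: of_nat_diff algebra_simps)
    finally have "real m * real (Suc m) * (real (Suc m) * e) \<le> real m * real (Suc m) * layer_energy A r F"
      by (simp add: mult_ac)
    then show ?thesis using s by (simp add: e_def cA)
  qed
qed

section \<open>Transfer to 0-1 configurations\<close>

lemma sum_ordered_pairs:
  fixes g :: "nat \<Rightarrow> nat \<Rightarrow> real"
  assumes "\<And>i. g i i = 0"
  shows "(\<Sum>i\<in>{1..n}. \<Sum>j\<in>{1..n}. g i j) = (\<Sum>i\<in>{1..n}. \<Sum>j\<in>{i<..n}. g i j + g j i)"
proof -
  have "(\<Sum>i\<in>{1..n}. \<Sum>j\<in>{1..n}. g i j) =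
      (\<Sum>i\<in>{1..n}. (\<Sum>j\<in>{j \<in> {1..n}. i < j}. g i j) + (\<Sum>j\<in>{j \<in> {1..n}. j < i}. g i j))"
  proof (rule sum.cong[OF refl])
    fix i assume i: "i \<in> {1..n}"
    have "{1..n} = insert i ({j \<in> {1..n}. i < j} \<union> {j \<in> {1..n}. j < i})"
      using i by auto
    then have "(\<Sum>j\<in>{1..n}. g i j) = (\<Sum>j\<in>insert i ({j \<in> {1..n}. i < j} \<union> {j \<in> {1..n}. j < i}). g i j)"
      by (rule arg_cong)
    also have "\<dots> = g i i + ((\<Sum>j\<in>{j \<in> {1..n}. i < j}. g i j) + (\<Sum>j\<in>{j \<in> {1..n}. j < i}. g i j))"
      by (subst sum.insert) (auto intro!: sum.union_disjoint)
    finally show "(\<Sum>j\<in>{1..n}. g i j) =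
        (\<Sum>j\<in>{j \<in> {1..n}. i < j}. g i j) + (\<Sum>j\<in>{j \<in> {1..n}. j < i}. g i j)"
      by (simp only: assms add_0)
  qed
  also have "\<dots> = (\<Sum>i\<in>{1..n}. \<Sum>j\<in>{j \<in> {1..n}. i < j}. g i j)
      + (\<Sum>i\<in>{1..n}. \<Sum>j\<in>{j \<in> {1..n}. i < j}. g j i)"
    unfolding sum.distrib by (subst (2) sum.swap_restrict) simp_all
  also have "\<dots> = (\<Sum>i\<in>{1..n}. \<Sum>j\<in>{j \<in> {1..n}. i < j}. g i j + g j i)"
    by (simp only: sum.distrib)
  also have "\<dots> = (\<Sum>i\<in>{1..n}. \<Sum>j\<in>{i<..n}. g i j + g j i)"
    by (intro sum.cong) auto
  finally show ?thesis .
qed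

lemma switch_involutory [simp]: "switch i j (switch i j \<eta>) = \<eta>"
  by (simp add: switch_def comp_assoc)

lemma finite_slice: "finite (slice n r)"
proof (rule finite_subset)
  show "slice n r \<subseteq> {1..n} \<rightarrow>\<^sub>E {0, 1}" by (auto simp: slice_def)
qed (auto intro: finite_PiE)

text \<open>A configuration corresponds to the set of its ones; \<open>restrict\<close> supplies the
  \<open>undefined\<close> values outside \<open>{1..n}\<close>.\<close>

lemma bij_betw_layer_slice:
  "bij_betw (\<lambda>B. restrict (indicator B) {1..n}) (layer {1..n} r) (slice n r)"
proof (rule bij_betw_byWitness[where f' = "\<lambda>\<eta>. {i \<in> {1..n}. \<eta> i = 1}"])
  show "\<forall>B\<in>layer {1..n} r. {i \<in> {1..n}. restrict (indicator B) {1..n} i = (1::nat)} = B"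
    by (auto simp: layer_def indicator_def)
  show "\<forall>\<eta>\<in>slice n r. restrict (indicator {i \<in> {1..n}. \<eta> i = 1}) {1..n} = \<eta>"
  proof (intro ballI ext)
    fix \<eta> i assume "\<eta> \<in> slice n r"
    then have "\<eta> \<in> {1..n} \<rightarrow>\<^sub>E {0, 1}" by (simp add: slice_def)
    then show "restrict (indicator {i \<in> {1..n}. \<eta> i = 1}) {1..n} i = \<eta> i"
      by (cases "i \<in> {1..n}") (auto simp: indicator_def PiE_iff extensional_def)
  qed
  show "(\<lambda>B. restrict (indicator B) {1..n}) ` layer {1..n} r \<subseteq> slice n r"
  proof safe
    fix B assume B: "B \<in> layer {1..n} r"
    then have "{1..n} \<inter> B = B" by (auto simp: layer_def)
    then have "(\<Sum>i\<in>{1..n}. indicator B i) = r"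
      using B by (simp add: layer_def indicator_def sum.If_cases)
    then show "restrict (indicator B) {1..n} \<in> slice n r"
      by (auto simp: slice_def indicator_def)
  qed
  show "(\<lambda>\<eta>. {i \<in> {1..n}. \<eta> i = 1}) ` slice n r \<subseteq> layer {1..n} r"
  proof safe
    fix \<eta> assume \<eta>: "\<eta> \<in> slice n r"
    then have "\<eta> i = (if \<eta> i = 1 then 1 else 0)" if "i \<in> {1..n}" for i
      using that by (auto simp: slice_def PiE_iff)
    then have "(\<Sum>i\<in>{1..n}. \<eta> i) = (\<Sum>i\<in>{1..n}. if \<eta> i = 1 then 1 else 0)"
      by (intro sum.cong) auto
    also have "\<dots> = card {i \<in> {1..n}. \<eta> i = 1}"
      by (simp add: sum.If_cases Int_def)
    finally show "{i \<in> {1..n}. \<eta> i = 1} \<in> layer {1..n} r"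
      using \<eta> by (auto simp: slice_def layer_def)
  qed
qed

lemma switch_restrict_indicator:
  assumes "i \<in> {1..n}" "j \<in> {1..n}" "i \<in> B" "j \<notin> B"
  shows "switch i j (restrict (indicator B) {1..n}) = restrict (indicator (insert j (B - {i}))) {1..n}"
  using assms by (auto simp: switch_def fun_eq_iff indicator_def Transposition.transpose_def)

text \<open>The layer inequality carried over by the support bijection. Moves of
  \<open>layer_energy\<close> are ordered pairs from \<open>B\<close> and its complement; on
  configurations they become transpositions with \<open>i < j\<close>.\<close>

lemma slice_modified_log_sobolev:
  assumes "r \<le> n" "\<And>\<eta>. F \<eta> > 0"
  shows "real n * entropy_sum (slice n r) F \<le>
     (\<Sum>\<eta>\<in>slice n r. \<Sum>i\<in>{1..n}. \<Sum>j\<in>{i<..n}. log_gap (F \<eta>) (F (switch i j \<eta>)))"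
proof -
  let ?c = "\<lambda>B. restrict (indicator B) {1..n} :: nat \<Rightarrow> nat"
  let ?L = "layer {1..n} r"
  have re: "sum g (slice n r) = (\<Sum>B\<in>?L. g (?c B))" for g :: "_ \<Rightarrow> real"
    by (rule sum.reindex_bij_betw[OF bij_betw_layer_slice, symmetric])
  have "card (slice n r) = card ?L"
    using bij_betw_same_card[OF bij_betw_layer_slice] by metis
  then have "entropy_sum (slice n r) F = entropy_sum ?L (\<lambda>B. F (?c B))"
    by (simp add: entropy_sum_def re)
  then have "real n * entropy_sum (slice n r) F \<le> layer_energy {1..n} r (\<lambda>B. F (?c B))"
    using layer_modified_log_sobolev[of "{1..n}" r "\<lambda>B. F (?c B)"] assms by simp
  also have "\<dots> \<le> (\<Sum>B\<in>?L. \<Sum>i\<in>{1..n}. \<Sum>j\<in>{i<..n}. log_gap (F (?c B)) (F (switch i j (?c B))))"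
    unfolding layer_energy_def
  proof (rule sum_mono)
    fix B assume "B \<in> ?L"
    then have B: "B \<subseteq> {1..n}" by (simp add: layer_def)
    \<comment> \<open>Extension by zero to all ordered pairs. At most one of \<open>?g i j\<close>
      and \<open>?g j i\<close> has its condition satisfied, so folding to \<open>i < j\<close>
      counts no transposition twice.\<close>
    let ?g = "\<lambda>i j. if i \<in> B \<and> j \<notin> B then log_gap (F (?c B)) (F (switch i j (?c B))) else 0"
    have "(\<Sum>i\<in>B. \<Sum>j\<in>{1..n} - B. log_gap (F (?c B)) (F (?c (insert j (B - {i})))))
        = (\<Sum>i\<in>B. \<Sum>j\<in>{1..n} - B. ?g i j)"
    proof (rule sum.cong[OF refl], rule sum.cong[OF refl])
      fix i j assume "i \<in> B" "j \<in> {1..n} - B"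
      with B have "?c (insert j (B - {i})) = switch i j (?c B)"
        by (intro switch_restrict_indicator[symmetric]) auto
      with \<open>i \<in> B\<close> \<open>j \<in> {1..n} - B\<close>
      show "log_gap (F (?c B)) (F (?c (insert j (B - {i})))) = ?g i j" by simp
    qed
    also have "\<dots> = (\<Sum>i\<in>B. \<Sum>j\<in>{1..n}. ?g i j)"
      by (intro sum.cong refl sum.mono_neutral_left) auto
    also have "\<dots> = (\<Sum>i\<in>{1..n}. \<Sum>j\<in>{1..n}. ?g i j)"
      using B by (intro sum.mono_neutral_left) auto
    also have "\<dots> = (\<Sum>i\<in>{1..n}. \<Sum>j\<in>{i<..n}. ?g i j + ?g j i)"
      by (rule sum_ordered_pairs) simp
    also have "\<dots> \<le> (\<Sum>i\<in>{1..n}. \<Sum>j\<in>{i<..n}. log_gap (F (?c B)) (F (switch i j (?c B))))"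
    proof (intro sum_mono)
      fix i j
      have "switch j i = switch i j"
        by (simp add: switch_def fun_eq_iff transpose_commute)
      then show "?g i j + ?g j i \<le> log_gap (F (?c B)) (F (switch i j (?c B)))"
        by (auto intro: log_gap_nonneg assms)
    qed
    finally show "(\<Sum>i\<in>B. \<Sum>j\<in>{1..n} - B. log_gap (F (?c B)) (F (?c (insert j (B - {i})))))
        \<le> (\<Sum>i\<in>{1..n}. \<Sum>j\<in>{i<..n}. log_gap (F (?c B)) (F (switch i j (?c B))))" .
  qed
  also have "\<dots> = (\<Sum>\<eta>\<in>slice n r. \<Sum>i\<in>{1..n}. \<Sum>j\<in>{i<..n}. log_gap (F \<eta>) (F (switch i j \<eta>)))"
    by (rule re[symmetric])
  finally show ?thesis .
qed

text \<open>Reversibility: each transposition is an involution of the slice and so preserves the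
  counting measure.\<close>

lemma sum_slice_switch:
  fixes h :: "(nat \<Rightarrow> nat) \<Rightarrow> (nat \<Rightarrow> nat) \<Rightarrow> real"
  shows "(\<Sum>\<eta>\<in>slice n r. \<Sum>i\<in>{1..n}. \<Sum>j\<in>{i<..n}. h \<eta> (switch i j \<eta>)) =
    (\<Sum>\<eta>\<in>slice n r. \<Sum>i\<in>{1..n}. \<Sum>j\<in>{i<..n}. h (switch i j \<eta>) \<eta>)"
proof -
  have "(\<Sum>\<eta>\<in>slice n r. h \<eta> (switch i j \<eta>)) = (\<Sum>\<eta>\<in>slice n r. h (switch i j \<eta>) \<eta>)"
    if "i \<in> {1..n}" "j \<in> {i<..n}" for i j
    by (rule sum.reindex_bij_witness[where i = "switch i j" and j = "switch i j"])
       (use that in \<open>auto intro!: switch_in_slice\<close>)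
  then have "(\<Sum>i\<in>{1..n}. \<Sum>j\<in>{i<..n}. \<Sum>\<eta>\<in>slice n r. h \<eta> (switch i j \<eta>)) =
      (\<Sum>i\<in>{1..n}. \<Sum>j\<in>{i<..n}. \<Sum>\<eta>\<in>slice n r. h (switch i j \<eta>) \<eta>)"
    by (blast intro: sum.cong)
  then show ?thesis
    by (simp only: sum.swap[of _ "slice n r"])
qed

section \<open>Pointwise exponential inequalities\<close>

text \<open>The logarithmic mean of \<open>exp x\<close> and \<open>exp y\<close> is at most their
  arithmetic mean. By symmetry \<open>y \<le> x\<close>, and division by \<open>exp y\<close> leaves
  an inequality in \<open>t = x - y\<close>.\<close>

lemma log_gap_exp_le_square:
  "log_gap (exp x) (exp y) \<le> (exp x + exp y) / 2 * (x - y)\<^sup>2"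
proof -
  have *: "(exp x - exp y) * (x - y) \<le> (exp x + exp y) / 2 * (x - y)\<^sup>2" if "y \<le> x" for x y :: real
  proof -
    define g where "g t = (exp t + 1) * t / 2 - exp t + 1" for t :: real
    have "g 0 \<le> g (x - y)"
    proof (rule DERIV_nonneg_imp_nondecreasing[of 0 "x - y" g])
      fix t :: real
      have "(g has_real_derivative exp t * (t + exp (- t) - 1) / 2) (at t)"
        unfolding g_def
        by (auto intro!: derivative_eq_intros simp: field_simps simp flip: exp_add)
      \<comment> \<open>The derivative is written so that its sign is that of
        \<open>exp (- t) - (1 - t)\<close>.\<close>
      moreover have "exp t * (t + exp (- t) - 1) / 2 \<ge> 0"
        using exp_ge_add_one_self[of "- t"] by simp
      ultimately show "\<exists>d. (g has_real_derivative d) (at t) \<and> d \<ge> 0" by blast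
    qed (use that in simp)
    then have "exp (x - y) - 1 \<le> (exp (x - y) + 1) * (x - y) / 2"
      by (simp add: g_def)
    then have "exp y * (exp (x - y) - 1) \<le> exp y * ((exp (x - y) + 1) * (x - y) / 2)"
      by (rule mult_left_mono) simp
    moreover have "exp y * exp (x - y) = exp x" by (simp flip: exp_add)
    ultimately have "exp x - exp y \<le> (exp x + exp y) / 2 * (x - y)"
      by (simp add: algebra_simps)
    from mult_right_mono[OF this, of "x - y"] that show ?thesis
      by (simp add: power2_eq_square mult.assoc)
  qed
  show ?thesis
  proof (cases "y \<le> x")
    case True
    with *[of y x] show ?thesis by (simp add: log_gap_def)
  next
    case False
    then have "(exp y - exp x) * (y - x) \<le> (exp y + exp x) / 2 * (y - x)\<^sup>2"
      by (intro *) simp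
    then show ?thesis
      by (simp add: log_gap_def power2_commute[of x y] add.commute algebra_simps)
  qed
qed

text \<open>One positive part vanishes; for the other, \<open>1 - exp (- t) \<le> t\<close> with
  \<open>t\<close> the distance between \<open>x\<close> and \<open>y\<close>.\<close>

lemma log_gap_exp_le_pos_part:
  "log_gap (exp x) (exp y) \<le> exp x * (max (x - y) 0)\<^sup>2 + exp y * (max (y - x) 0)\<^sup>2"
proof -
  have *: "(exp x - exp y) * (x - y) \<le> exp x * (x - y)\<^sup>2" if "y \<le> x" for x y :: real
  proof -
    have "1 + (y - x) \<le> exp (y - x)" by (rule exp_ge_add_one_self)
    then have "exp x * (1 + (y - x)) \<le> exp x * exp (y - x)" by simp
    then have "exp x - exp y \<le> exp x * (x - y)"
      by (simp add: algebra_simps flip: exp_add)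
    from mult_right_mono[OF this, of "x - y"] that show ?thesis
      by (simp add: power2_eq_square mult.assoc)
  qed
  show ?thesis
  proof (cases "y \<le> x")
    case True
    with *[of y x] show ?thesis by (simp add: log_gap_def)
  next
    case False
    with *[of x y] show ?thesis by (simp add: log_gap_def algebra_simps)
  qed
qed

section \<open>From the entropy bound to the logarithmic Sobolev inequalities\<close>

text \<open>The common part of both claims, with \<open>\<psi>\<close> the square or the squared
  positive part. The pointwise bound may be symmetric in \<open>x\<close> and \<open>y\<close>,
  since reversibility merges its two halves after summation.\<close>

lemma mLSI_slice_measure:
  fixes \<psi> :: "real \<Rightarrow> real"
  assumes "r \<le> n"
    and \<psi>: "\<And>x y. log_gap (exp x) (exp y) \<le> c / 2 * (exp x * \<psi> (x - y) + exp y * \<psi> (y - x))"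
    and \<Gamma>: "\<And>f \<eta>. (\<Gamma> f \<eta>)\<^sup>2 =
           2 / real n * (\<Sum>i\<in>{1..n}. \<Sum>j\<in>{i<..n}. \<psi> (f \<eta> - f (switch i j \<eta>)))"
  shows "mLSI (slice_measure n r) \<Gamma> c"
  unfolding mLSI_def
proof (intro conjI allI)
  let ?X = "slice n r"
  have "layer {1..n} r \<noteq> {}"
    using assms(1) by (intro layer_nonempty) auto
  then have ne: "?X \<noteq> {}"
    using bij_betw_layer_slice[of n r] by (auto simp: bij_betw_def)
  show "prob_space (slice_measure n r)"
    unfolding slice_measure_def by (rule prob_space_uniform_count_measure[OF finite_slice ne])
  define N where "N = real (card ?X)"
  have N: "N > 0" using ne finite_slice by (simp add: N_def card_gt_0_iff)
  have int: "(LINT x|slice_measure n r. g x) = sum g ?X / N" for g :: "_ \<Rightarrow> real"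
    unfolding slice_measure_def N_def by (rule integral_uniform_count_measure[OF finite_slice])
  fix f :: "(nat \<Rightarrow> nat) \<Rightarrow> real"
  let ?F = "\<lambda>\<eta>. exp (f \<eta>)"
  let ?S = "\<lambda>h. \<Sum>\<eta>\<in>?X. \<Sum>i\<in>{1..n}. \<Sum>j\<in>{i<..n}. h \<eta> (switch i j \<eta>) :: real"
  let ?R = "?S (\<lambda>\<eta> \<xi>. ?F \<eta> * \<psi> (f \<eta> - f \<xi>))"
  have "real n * entropy_sum ?X ?F \<le> ?S (\<lambda>\<eta> \<xi>. log_gap (?F \<eta>) (?F \<xi>))"
    using assms(1) by (intro slice_modified_log_sobolev) auto
  also have "\<dots> \<le> ?S (\<lambda>\<eta> \<xi>. c / 2 * (?F \<eta> * \<psi> (f \<eta> - f \<xi>) + ?F \<xi> * \<psi> (f \<xi> - f \<eta>)))"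
    by (intro sum_mono \<psi>)
  also have "\<dots> = c / 2 * (?R + ?S (\<lambda>\<eta> \<xi>. ?F \<xi> * \<psi> (f \<xi> - f \<eta>)))"
    by (simp only: sum.distrib flip: sum_distrib_left)
  also have "?S (\<lambda>\<eta> \<xi>. ?F \<xi> * \<psi> (f \<xi> - f \<eta>)) = ?R"
    by (rule sum_slice_switch)
  finally have main: "real n * entropy_sum ?X ?F \<le> c * ?R" by simp
  \<comment> \<open>For \<open>n = 0\<close> the quotient is zero by convention, and so is the
    entropy, as the slice is a single point.\<close>
  have "entropy_sum ?X ?F \<le> c * ?R / real n"
  proof (cases "n = 0")
    case True
    then have "layer {1..n} r = {{}}"
      using assms(1) by (auto simp: layer_def)
    then obtain \<eta> where "?X = {\<eta>}"
      using bij_betw_layer_slice[of n r] by (auto simp: bij_betw_def)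
    then show ?thesis using True by simp
  qed (use main in \<open>simp add: pos_le_divide_eq mult.commute\<close>)
  then have "entropy_sum ?X ?F / N \<le> c * ?R / real n / N"
    by (rule divide_right_mono) (use N in simp)
  moreover have "Ent (slice_measure n r) ?F = entropy_sum ?X ?F / N"
    by (simp add: Ent_def int entropy_sum_def N_def diff_divide_distrib)
  moreover have "(LINT x|slice_measure n r. (\<Gamma> f x)\<^sup>2 * ?F x) = 2 / real n * ?R / N"
    unfolding int \<Gamma> by (simp add: sum_distrib_left sum_distrib_right mult_ac)
  ultimately show "Ent (slice_measure n r) ?F \<le> c / 2 * (LINT x|slice_measure n r. (\<Gamma> f x)\<^sup>2 * ?F x)"
    by simp
qed

theorem proposition1p10:
  fixes n r :: nat
  assumes "r \<le> n"
  shows "mLSI (slice_measure n r) (Gamma_slice n) 1 \<and> mLSI (slice_measure n r) (Gamma_slice_plus n) 2"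
proof
  show "mLSI (slice_measure n r) (Gamma_slice n) 1"
  \<comment> \<open>The square takes both signs of a difference into account, so the mean
    \<open>(exp x + exp y) / 2\<close> suffices and gives constant 1; the positive part keeps one
    sign and needs the full weight, hence constant 2 below.\<close>
  proof (rule mLSI_slice_measure[OF assms, where \<psi> = "\<lambda>t. t\<^sup>2"])
    show "log_gap (exp x) (exp y) \<le> 1 / 2 * (exp x * (x - y)\<^sup>2 + exp y * (y - x)\<^sup>2)" for x y
      using log_gap_exp_le_square[of x y] by (simp add: power2_commute[of y x] algebra_simps)
  qed (simp add: Gamma_slice_def sum_nonneg)
  show "mLSI (slice_measure n r) (Gamma_slice_plus n) 2"
  proof (rule mLSI_slice_measure[OF assms, where \<psi> = "\<lambda>t. (max t 0)\<^sup>2"])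
    show "log_gap (exp x) (exp y) \<le> 2 / 2 * (exp x * (max (x - y) 0)\<^sup>2 + exp y * (max (y - x) 0)\<^sup>2)" for x y
      using log_gap_exp_le_pos_part[of x y] by simp
  qed (simp add: Gamma_slice_plus_def sum_nonneg)
qed

end
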